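(* Let $f:\mathbb{N}\to\mathbb{C}$ with $f(1)\ne0$, and let $\alpha,\beta:(0,\infty)\to\mathbb{C}$ be functions with $\alpha(x)=\beta(x)=0$ for $x\in(0,1)$. If $$\alpha(x)=\sum_{n\le x}\frac{f(n)}{\xi(n)}\beta(x/n)\quad\text{for all }x\ge1,$$ then $$\beta(x)=\sum_{n\le x}\frac{f^{-1\circ}(n)}{\xi(n)}\alpha(x/n)\quad\text{for all }x\ge1.$$
   Context: Writing $n=\prod_p p^{\nu_p(n)}$, $\xi(n)=\prod_p\nu_p(n)!$. The binomial convolution is $(f\circ g)(n)=\sum_{d\mid n}\left(\prod_p\binom{\nu_p(n)}{\nu_p(d)}\right)f(d)g(n/d)$, with identity $\delta$ ($\delta(1)=1$, $\delta(n)=0$ for $n>1$); $f^{-1\circ}$ is the inverse of $f$ under $\circ$. Sums $\sum_{n\le x}$ run over positive integers $n\le x$. *)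

theory Defs
  imports Complex_Main "HOL-Computational_Algebra.Computational_Algebra"
begin

text \<open>
  Arithmetic functions are functions on the positive integers; they are encoded as
  total functions of type \<open>nat \<Rightarrow> complex\<close> whose value at \<open>0\<close> carries no meaning.
  Products over all primes are restricted to the prime factors of \<open>n\<close>: for \<open>n \<ge> 1\<close>
  and \<open>d dvd n\<close>, every other prime contributes a factor \<open>fact 0 = 1\<close> or \<open>0 choose 0 = 1\<close>.
\<close>

definition xi :: "nat \<Rightarrow> nat" where
  "xi n = (\<Prod>p\<in>prime_factors n. fact (multiplicity p n))"

text \<open>The sum is over an infinite set for \<open>n = 0\<close>, so the value there is \<open>0\<close>.\<close>

definition binom_conv :: "(nat \<Rightarrow> complex) \<Rightarrow> (nat \<Rightarrow> complex) \<Rightarrow> nat \<Rightarrow> complex" where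
  "binom_conv f g n =
     (\<Sum>d | d dvd n.
        of_nat (\<Prod>p\<in>prime_factors n. multiplicity p n choose multiplicity p d)
          * f d * g (n div d))"

definition conv_unit :: "nat \<Rightarrow> complex" where
  "conv_unit n = (if n = 1 then 1 else 0)"

text \<open>
  The inverse is determined on the positive integers only; the convention \<open>g 0 = 0\<close>
  makes it unique as a total function. It exists exactly when \<open>f 1 \<noteq> 0\<close>.
\<close>

definition binom_inverse :: "(nat \<Rightarrow> complex) \<Rightarrow> nat \<Rightarrow> complex" where
  "binom_inverse f =
     (THE g. g 0 = 0 \<and>
        (\<forall>n\<ge>1. binom_conv f g n = conv_unit n \<and> binom_conv g f n = conv_unit n))"

end

theory Submission
  imports Defs
begin

text \<open>
  Since \<open>\<Prod>\<^sub>p (\<nu>\<^sub>p(n) choose \<nu>\<^sub>p(d)) = \<xi>(n) / (\<xi>(d) \<xi>(n/d))\<close>, dividing by \<open>\<xi>\<close> turns the binomial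
  convolution into the Dirichlet convolution. Substituting the hypothesis into the right-hand side
  and grouping the terms by \<open>k = m n\<close> then gives \<open>\<Sum>\<^sub>k\<^sub>\<le>\<^sub>x (\<delta>(k) / \<xi>(k)) \<beta>(x/k) = \<beta>(x)\<close>.
\<close>

lemma xi_pos: "xi n > 0"
  unfolding xi_def by (intro prod_pos) simp

lemma xi_1 [simp]: "xi (Suc 0) = 1"
  by (simp add: xi_def)

text \<open>This allows \<open>xi a\<close>, \<open>xi b\<close> and \<open>xi (a * b)\<close> to be
  compared factor by factor over one common index set, the primes dividing
  \<open>a * b\<close>.\<close>

lemma xi_eq_prod_superset:
  assumes "finite P" "prime_factors n \<subseteq> P" "\<And>p. p \<in> P \<Longrightarrow> prime p"
  shows "xi n = (\<Prod>p\<in>P. fact (multiplicity p n))"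
  unfolding xi_def
proof (rule prod.mono_neutral_left[OF assms(1,2)], safe)
  fix p assume "p \<in> P" "p \<notin> prime_factors n"
  \<comment> \<open>The case n = 0 is covered by the default
    \<open>multiplicity p 0 = 0\<close>.\<close>
  then have "multiplicity p n = 0"
    using assms(3) by (cases "n = 0") (auto simp: prime_factors_multiplicity)
  then show "fact (multiplicity p n) = (1::nat)" by simp
qed

text \<open>Multiplicities add under multiplication, so at each prime this is (i + j)! = (i + j
  choose i) i! j!.\<close>

lemma xi_mult_binomial:
  assumes "a > 0" "b > 0"
  shows "xi (a * b)
       = (\<Prod>p\<in>prime_factors (a * b). multiplicity p (a * b) choose multiplicity p a) * xi a * xi b"
proof -
  let ?P = "prime_factors (a * b)"
  have sub: "prime_factors a \<subseteq> ?P" "prime_factors b \<subseteq> ?P"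
    using assms by (auto simp: prime_factors_product)
  have pr: "\<And>p. p \<in> ?P \<Longrightarrow> prime p" by auto
  have "xi (a * b) = (\<Prod>p\<in>?P. (multiplicity p (a * b) choose multiplicity p a) *
      fact (multiplicity p a) * fact (multiplicity p b))"
    unfolding xi_def
  proof (intro prod.cong refl)
    fix p assume "p \<in> ?P"
    then have m: "multiplicity p (a * b) = multiplicity p a + multiplicity p b"
      using assms by (intro prime_elem_multiplicity_mult_distrib) auto
    show "fact (multiplicity p (a * b)) = (multiplicity p (a * b) choose multiplicity p a) *
      fact (multiplicity p a) * fact (multiplicity p b)"
      unfolding m using binomial_fact_lemma[of "multiplicity p a" "multiplicity p a + multiplicity p b"]
      by (simp add: mult_ac)
  qed
  then show ?thesis
    by (simp add: prod.distrib xi_eq_prod_superset[OF _ sub(1) pr] xi_eq_prod_superset[OF _ sub(2) pr])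
qed

lemma binom_conv_eq_dirichlet:
  assumes "n > 0"
  shows "binom_conv f g n
       = of_nat (xi n) * (\<Sum>d | d dvd n. f d / of_nat (xi d) * (g (n div d) / of_nat (xi (n div d))))"
  unfolding binom_conv_def sum_distrib_left
proof (intro sum.cong refl, clarify)
  fix d assume "d dvd n"
  then obtain e where n: "n = d * e" by blast
  with assms have pos: "d > 0" "e > 0" by auto
  have "complex_of_nat (xi d) \<noteq> 0" "complex_of_nat (xi e) \<noteq> 0"
    using xi_pos[of d] xi_pos[of e] by simp_all
  then show "of_nat (\<Prod>p\<in>prime_factors n. multiplicity p n choose multiplicity p d) * f d * g (n div d)
      = of_nat (xi n) * (f d / of_nat (xi d) * (g (n div d) / of_nat (xi (n div d))))"
    using pos unfolding n by (simp add: xi_mult_binomial field_simps)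
qed

text \<open>In the Dirichlet form the summand is visibly symmetric under d \<mapsto> n / d, with no
  need to invoke the symmetry of the binomial coefficients.\<close>

lemma binom_conv_commute:
  assumes "n > 0"
  shows "binom_conv f g n = binom_conv g f n"
  unfolding binom_conv_eq_dirichlet[OF assms]
  by (rule arg_cong[where f = "(*) _"],
      rule sum.reindex_bij_witness[of _ "\<lambda>d. n div d" "\<lambda>d. n div d"])
     (use assms in \<open>auto simp: div_dvd_iff_mult mult.commute\<close>)

text \<open>The divisor 1 gives the only term containing \<open>g n\<close>, and its binomial
  coefficients are all 1. Both existence and uniqueness of the inverse come from solving for this
  term.\<close>

lemma binom_conv_split_1:
  assumes "n > 0"
  shows "binom_conv f g n = f 1 * g n + (\<Sum>d | d dvd n \<and> d \<noteq> 1.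
       of_nat (\<Prod>p\<in>prime_factors n. multiplicity p n choose multiplicity p d) * f d * g (n div d))"
proof -
  have "{d. d dvd n} = insert 1 {d. d dvd n \<and> d \<noteq> 1}" by auto
  moreover have "finite {d. d dvd n \<and> d \<noteq> 1}" using assms by simp
  ultimately show ?thesis unfolding binom_conv_def by simp
qed

lemma div_divisor_less:
  fixes n d :: nat
  assumes "n > 0" "d dvd n" "d \<noteq> 1"
  shows "n div d < n"
  using assms by (cases "d = 0") auto

text \<open>The candidate inverse: the equation \<open>binom_conv f g n = conv_unit n\<close> solved
  for \<open>g n\<close>, with the value at 0 prescribed by \<open>binom_inverse\<close>.\<close>

function binom_inv_rec :: "(nat \<Rightarrow> complex) \<Rightarrow> nat \<Rightarrow> complex" where
  "binom_inv_rec f n = (if n = 0 then 0 else (conv_unit n - (\<Sum>d | d dvd n \<and> d \<noteq> 1.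
       of_nat (\<Prod>p\<in>prime_factors n. multiplicity p n choose multiplicity p d)
         * f d * binom_inv_rec f (n div d))) / f 1)"
  by auto
termination
  by (relation "measure snd") (auto intro: div_divisor_less)

declare binom_inv_rec.simps [simp del]

text \<open>Strong induction: every term with d \<noteq> 1 involves only arguments below n, so the
  two convolutions can differ only in the terms \<open>f 1 * g n\<close> and
  \<open>f 1 * h n\<close>.\<close>

lemma binom_conv_left_cancel:
  assumes "f 1 \<noteq> 0" and eq: "\<And>n. n > 0 \<Longrightarrow> binom_conv f g n = binom_conv f h n" and "n > 0"
  shows "g n = h n"
  using \<open>n > 0\<close>
proof (induction n rule: less_induct)
  case (less n)
  have "g (n div d) = h (n div d)" if "d dvd n" "d \<noteq> 1" for d
    using less that div_divisor_less[of n d] by (metis dvd_div_eq_0_iff gr0I less_numeral_extra(3))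
  then have "(\<Sum>d | d dvd n \<and> d \<noteq> 1.
       of_nat (\<Prod>p\<in>prime_factors n. multiplicity p n choose multiplicity p d) * f d * g (n div d))
    = (\<Sum>d | d dvd n \<and> d \<noteq> 1.
       of_nat (\<Prod>p\<in>prime_factors n. multiplicity p n choose multiplicity p d) * f d * h (n div d))"
    by (intro sum.cong) auto
  then show ?case
    using eq[OF less.prems] assms(1) unfolding binom_conv_split_1[OF less.prems] by simp
qed

text \<open>The definite description is justified by the recursive witness for existence and by left
  cancellation for uniqueness.\<close>

lemma binom_conv_binom_inverse:
  assumes "f 1 \<noteq> 0" "n > 0"
  shows "binom_conv (binom_inverse f) f n = conv_unit n"
proof -
  let ?inv = "\<lambda>g. g 0 = 0 \<and>
    (\<forall>n\<ge>1. binom_conv f g n = conv_unit n \<and> binom_conv g f n = conv_unit n)"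
  have r: "binom_conv f (binom_inv_rec f) n = conv_unit n" if "n > 0" for n
    using that assms(1)
    \<comment> \<open>The recursion is unfolded at n only, so that the values at
      \<open>n div d\<close> under the sum stay folded and cancel.\<close>
    by (simp only: binom_conv_split_1 binom_inv_rec.simps[of f n]) simp
  have ex: "?inv (binom_inv_rec f)"
    using r binom_conv_commute[of _ "binom_inv_rec f" f]
    by (auto simp: binom_inv_rec.simps[of f 0])
  have "g = binom_inv_rec f" if g: "?inv g" for g
  proof
    fix n show "g n = binom_inv_rec f n"
      using g ex binom_conv_left_cancel[of f g "binom_inv_rec f" n] assms(1)
      by (cases "n = 0") (auto simp: Suc_le_eq)
  qed
  then have "?inv (binom_inverse f)"
    unfolding binom_inverse_def by (rule theI[where P = ?inv, OF ex])
  then show ?thesis using assms(2) by simp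
qed

lemma finite_nat_le_real: "finite {n. 1 \<le> n \<and> real n \<le> x}"
  by (rule finite_subset[of _ "{..nat \<lfloor>x\<rfloor>}"]) (auto simp: le_nat_floor)

text \<open>The pairs (n, m) with n m \<le> x correspond to the pairs (k, d) with d dividing k \<le>
  x, through k = n m and d = n.\<close>

lemma sum_nested_eq_sum_divisors:
  fixes a b :: "nat \<Rightarrow> complex"
  shows "(\<Sum>n | 1 \<le> n \<and> real n \<le> x. a n *
            (\<Sum>m | 1 \<le> m \<and> real m \<le> x / real n. b m * h (x / real n / real m)))
       = (\<Sum>k | 1 \<le> k \<and> real k \<le> x. (\<Sum>d | d dvd k. a d * b (k div d)) * h (x / real k))"
proof -
  have "(\<Sum>n | 1 \<le> n \<and> real n \<le> x. a n *
            (\<Sum>m | 1 \<le> m \<and> real m \<le> x / real n. b m * h (x / real n / real m)))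
      = (\<Sum>(n, m)\<in>(SIGMA n:{n. 1 \<le> n \<and> real n \<le> x}. {m. 1 \<le> m \<and> real m \<le> x / real n}).
            a n * (b m * h (x / real n / real m)))"
    using finite_nat_le_real by (simp add: sum_distrib_left sum.Sigma)
  also have "\<dots> = (\<Sum>(k, d)\<in>(SIGMA k:{k. 1 \<le> k \<and> real k \<le> x}. {d. d dvd k}).
            a d * b (k div d) * h (x / real k))"
  proof (rule sum.reindex_bij_witness[of _ "\<lambda>(k, d). (d, k div d)" "\<lambda>(n, m). (n * m, n)"],
         goal_cases)
    \<comment> \<open>The bound on d has to be recovered from d e \<le> x, using e \<ge> 1.\<close>
    case (4 kd)
    then obtain d e where "kd = (d * e, d)" "d * e > 0" "real (d * e) \<le> x"
      by (auto elim!: dvdE)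
    moreover from this have "real d \<le> x"
      by (intro order.trans[OF _ \<open>real (d * e) \<le> x\<close>], subst of_nat_le_iff) auto
    ultimately show ?case by (auto simp: field_simps)
  qed (auto simp: field_simps)
  also have "\<dots> = (\<Sum>k | 1 \<le> k \<and> real k \<le> x. (\<Sum>d | d dvd k. a d * b (k div d)) * h (x / real k))"
    using finite_nat_le_real by (subst sum.Sigma[symmetric]) (auto simp: sum_distrib_right)
  finally show ?thesis .
qed

theorem theorem7p3:
  fixes f :: "nat \<Rightarrow> complex" and \<alpha> \<beta> :: "real \<Rightarrow> complex"
  assumes "f 1 \<noteq> 0"
    and "\<And>x. 0 < x \<Longrightarrow> x < 1 \<Longrightarrow> \<alpha> x = 0"
    and "\<And>x. 0 < x \<Longrightarrow> x < 1 \<Longrightarrow> \<beta> x = 0"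
    and "\<And>x. x \<ge> 1 \<Longrightarrow>
           \<alpha> x = (\<Sum>n | 1 \<le> n \<and> real n \<le> x. f n / of_nat (xi n) * \<beta> (x / real n))"
  shows "\<forall>x\<ge>1. \<beta> x =
           (\<Sum>n | 1 \<le> n \<and> real n \<le> x. binom_inverse f n / of_nat (xi n) * \<alpha> (x / real n))"
proof (intro allI impI)
  fix x :: real assume x: "x \<ge> 1"
  let ?a = "\<lambda>n. binom_inverse f n / of_nat (xi n)" and ?b = "\<lambda>n. f n / of_nat (xi n)"
  let ?N = "{n. 1 \<le> n \<and> real n \<le> x}"
  \<comment> \<open>The convolution identity carries a factor \<open>xi k\<close>: it is nonzero,
    and it equals 1 at k = 1.\<close>
  have conv: "(\<Sum>d | d dvd k. ?a d * ?b (k div d)) = (if k = 1 then 1 else 0)" if "k > 0" for k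
    using binom_conv_binom_inverse[of f k] assms(1) that xi_pos[of k]
    unfolding binom_conv_eq_dirichlet[OF that] conv_unit_def
    by (auto split: if_splits)
  \<comment> \<open>The hypothesis on \<alpha> applies at x / n because n \<le> x makes this at
    least 1.\<close>
  have "(\<Sum>n\<in>?N. ?a n * \<alpha> (x / real n))
      = (\<Sum>n\<in>?N. ?a n * (\<Sum>m | 1 \<le> m \<and> real m \<le> x / real n. ?b m * \<beta> (x / real n / real m)))"
    by (intro sum.cong refl arg_cong2[where f = "(*)"] assms(4)) auto
  also have "\<dots> = (\<Sum>k\<in>?N. (\<Sum>d | d dvd k. ?a d * ?b (k div d)) * \<beta> (x / real k))"
    by (rule sum_nested_eq_sum_divisors)
  also have "\<dots> = (\<Sum>k\<in>?N. if k = 1 then \<beta> x else 0)"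
    by (intro sum.cong refl) (use conv in auto)
  \<comment> \<open>Since x \<ge> 1, the index 1 lies in the range of summation.\<close>
  also have "\<dots> = \<beta> x"
    using finite_nat_le_real[of x] x by simp
  finally show "\<beta> x = (\<Sum>n\<in>?N. ?a n * \<alpha> (x / real n))" ..
qed

end
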